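(* Let $p$ be a prime, let $\Gamma$ be the dual group of the compact group $G=(\mathbb{Z}/p\mathbb{Z})^{\mathbb{N}}$, and let $w$ be a real-valued nondecreasing function of $x\ge 1$ such that $w(x)\ge 1$ for all $x\ge 1$ and $\lim_{x\to\infty}w(x)=\infty$. Then there exists a subset $\Lambda$ of $\Gamma$ which is not a Sidon set and such that, for every integer $k\ge1$ and every $k$-mesh $M\subset\Gamma$, $$|\Lambda\cap M|\le k\,w(k).$$
   Context: $|S|$ denotes the cardinality of a set $S$. The dual group $\Gamma$ of a compact abelian group $G$ is the discrete abelian group of continuous characters of $G$; as an abstract group it is written additively, and $\gamma(g)\in\mathbb{C}$ denotes the value of the character $\gamma\in\Gamma$ at $g\in G$. Sidon sets: for $S\ge1$, a subset $\Lambda\subset\Gamma$ is $S$-Sidon if for every trigonometric polynomial $P(g)=\sum_{\gamma\in\Lambda}a_\gamma\,\gamma(g)$ (finite sum, $a_\gamma\in\mathbb{C}$) one has $\sum_{\gamma}|a_\gamma|\le S\,\sup_{g\in G}|P(g)|$. $\Lambda$ is Sidon if it is $S$-Sidon for some $S\ge1$. For an integer $k\ge1$, a $k$-mesh in $\Gamma$ is a set of the form $$M=\Big\{\sum_{j=1}^k n_j\gamma_j : (n_1,\dots,n_k)\in E\Big\},$$ where $\gamma_1,\dots,\gamma_k\in\Gamma$ and $E$ is a subset of $\mathbb{Z}^k$. *)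

theory Defs
  imports
    "HOL-Analysis.Analysis"
    "HOL-Algebra.FiniteProduct"
    "HOL-Algebra.Elementary_Groups"
    "HOL-Algebra.Product_Groups"
    "HOL-Computational_Algebra.Primes"
begin

definition circle_group :: "complex monoid" where
  "circle_group = \<lparr>carrier = {z. cmod z = 1}, monoid.mult = (*), one = 1\<rparr>"

text \<open>
  The topological group is given by a group \<open>G\<close> and a topology \<open>T\<close> on its carrier. Characters are
  extensional functions on the carrier, so that distinct elements of the dual group are distinct
  as characters. The library's notation for groups is multiplicative: the group operation of the dual
  (an addition in the literature) appears below as \<open>\<otimes>\<close>, the integer multiple \<open>n \<gamma>\<close> as
  \<open>\<gamma> [^] n\<close>, and finite sums of group elements as \<open>finprod\<close>.
\<close>

definition dual_group :: "('a, 'm) monoid_scheme \<Rightarrow> 'a topology \<Rightarrow> ('a \<Rightarrow> complex) monoid" where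
  "dual_group G T =
     \<lparr>carrier = {\<gamma> \<in> extensional (carrier G).
                   \<gamma> \<in> hom G circle_group \<and> continuous_map T euclidean \<gamma>},
      monoid.mult = (\<lambda>\<gamma> \<delta>. \<lambda>g\<in>carrier G. \<gamma> g * \<delta> g),
      one = (\<lambda>g\<in>carrier G. 1)\<rparr>"

lemma comm_group_dual_group:
  assumes "group G" and "topspace T = carrier G"
  shows "comm_group (dual_group G T)"
proof -
  interpret group G by fact
  have carrier_iff: "\<gamma> \<in> carrier (dual_group G T) \<longleftrightarrow>
      \<gamma> \<in> extensional (carrier G) \<and> (\<forall>g\<in>carrier G. cmod (\<gamma> g) = 1) \<and>
      (\<forall>g\<in>carrier G. \<forall>h\<in>carrier G. \<gamma> (g \<otimes>\<^bsub>G\<^esub> h) = \<gamma> g * \<gamma> h) \<and>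
      continuous_map T euclidean \<gamma>" for \<gamma>
    by (auto simp: dual_group_def hom_def circle_group_def)
  have cont: "continuous_map T euclidean (restrict f (carrier G))"
    if "continuous_map T euclidean f" for f :: "'a \<Rightarrow> complex"
    using that by (rule continuous_map_eq) (simp add: assms(2))
  have cont_mult: "continuous_map T euclidean (\<lambda>g. f g * h g)"
    if "continuous_map T euclidean f" "continuous_map T euclidean h" for f h :: "'a \<Rightarrow> complex"
    using that by (simp add: continuous_map_atin tendsto_mult)
  have cont_cnj: "continuous_map T euclidean (\<lambda>g. cnj (f g))"
    if "continuous_map T euclidean f" for f :: "'a \<Rightarrow> complex"
    using that by (simp add: continuous_map_atin tendsto_cnj)
  show ?thesis
  proof (rule comm_groupI)
    fix x y assume xy: "x \<in> carrier (dual_group G T)" "y \<in> carrier (dual_group G T)"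
    then show "x \<otimes>\<^bsub>dual_group G T\<^esub> y \<in> carrier (dual_group G T)"
      unfolding carrier_iff by (simp add: dual_group_def cont cont_mult norm_mult)
    show "x \<otimes>\<^bsub>dual_group G T\<^esub> y = y \<otimes>\<^bsub>dual_group G T\<^esub> x"
      by (simp add: dual_group_def mult.commute)
  next
    show "\<one>\<^bsub>dual_group G T\<^esub> \<in> carrier (dual_group G T)"
      unfolding carrier_iff by (simp add: dual_group_def cont)
  next
    fix x y z
    show "x \<otimes>\<^bsub>dual_group G T\<^esub> y \<otimes>\<^bsub>dual_group G T\<^esub> z
      = x \<otimes>\<^bsub>dual_group G T\<^esub> (y \<otimes>\<^bsub>dual_group G T\<^esub> z)"
      by (simp add: dual_group_def fun_eq_iff mult.assoc)
  next
    fix x assume x: "x \<in> carrier (dual_group G T)"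
    then show "\<one>\<^bsub>dual_group G T\<^esub> \<otimes>\<^bsub>dual_group G T\<^esub> x = x"
      by (simp add: dual_group_def fun_eq_iff extensional_def)
    have "cnj (x g) * x g = 1" if "g \<in> carrier G" for g
      using x that unfolding carrier_iff
      by (metis complex_norm_square mult.commute of_real_1 one_power2)
    then have "(\<lambda>g\<in>carrier G. cnj (x g)) \<otimes>\<^bsub>dual_group G T\<^esub> x = \<one>\<^bsub>dual_group G T\<^esub>"
      by (simp add: dual_group_def fun_eq_iff)
    moreover have "(\<lambda>g\<in>carrier G. cnj (x g)) \<in> carrier (dual_group G T)"
      using x unfolding carrier_iff by (simp add: cont cont_cnj)
    ultimately show "\<exists>y\<in>carrier (dual_group G T). y \<otimes>\<^bsub>dual_group G T\<^esub> x = \<one>\<^bsub>dual_group G T\<^esub>"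
      by blast
  qed
qed

text \<open>
  In the definition of \<open>S\<close>-Sidon sets, \<open>F\<close> is the finite set of characters occurring in the
  trigonometric polynomial. The supremum is that of a bounded function on a nonempty set whenever
  \<open>\<Lambda>\<close> consists of characters.
\<close>

definition S_Sidon :: "('a, 'm) monoid_scheme \<Rightarrow> real \<Rightarrow> ('a \<Rightarrow> complex) set \<Rightarrow> bool" where
  "S_Sidon G S \<Lambda> \<longleftrightarrow>
     (\<forall>F (a :: ('a \<Rightarrow> complex) \<Rightarrow> complex). finite F \<and> F \<subseteq> \<Lambda> \<longrightarrow>
        (\<Sum>\<gamma>\<in>F. cmod (a \<gamma>)) \<le> S * (SUP g\<in>carrier G. cmod (\<Sum>\<gamma>\<in>F. a \<gamma> * \<gamma> g)))"

definition Sidon :: "('a, 'm) monoid_scheme \<Rightarrow> ('a \<Rightarrow> complex) set \<Rightarrow> bool" where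
  "Sidon G \<Lambda> \<longleftrightarrow> (\<exists>S\<ge>1. S_Sidon G S \<Lambda>)"

definition is_mesh :: "('c, 'm) monoid_scheme \<Rightarrow> nat \<Rightarrow> 'c set \<Rightarrow> bool" where
  "is_mesh \<Gamma> k M \<longleftrightarrow>
     (\<exists>(\<gamma> :: nat \<Rightarrow> 'c) (E :: (nat \<Rightarrow> int) set).
        \<gamma> \<in> {1..k} \<rightarrow> carrier \<Gamma> \<and> E \<subseteq> ({1..k} \<rightarrow>\<^sub>E UNIV) \<and>
        M = {finprod \<Gamma> (\<lambda>j. \<gamma> j [^]\<^bsub>\<Gamma>\<^esub> n j) {1..k} | n. n \<in> E})"

definition ZpN :: "nat \<Rightarrow> (nat \<Rightarrow> int) monoid" where
  "ZpN p = product_group UNIV (\<lambda>_. integer_mod_group p)"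

definition ZpN_topology :: "nat \<Rightarrow> (nat \<Rightarrow> int) topology" where
  "ZpN_topology p =
     product_topology (\<lambda>_. discrete_topology (carrier (integer_mod_group p))) UNIV"

lemma topspace_ZpN_topology: "topspace (ZpN_topology p) = carrier (ZpN p)"
  by (simp add: ZpN_def ZpN_topology_def)

end

(*
  Let the blocks A m be sets of m * n vectors in (Z/p)^n such that any K of them are linearly
  independent. The greedy Gilbert-Varshamov argument produces them with n = L * K, where L depends
  only on p and m, so that K may be taken so large that w K >= m * L, i.e. |A m| <= K * w K.
  Placing the blocks in independent direct summands of the dual group gives Lambda.

  If a k-mesh contains s_m elements of A m, then choosing min(s_m, K_m) of them in every block
  yields an independent set inside a group of order at most p^k, so these minima add up to at
  most k. Since s_m <= w k * min(s_m, K_m), the mesh contains at most k * w k elements of Lambda.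

  A sum of characters in A m with suitable signs is small: its value depends only on n
  coordinates, that is on p^n possible arguments, so its supremum norm is
  O(sqrt (|A m| * n)) = O(|A m| / sqrt m), while its coefficients sum to |A m|. Hence Lambda is
  not a Sidon set.
*)
theory Submission
  imports Defs "HOL-Number_Theory.Cong" "HOL-Library.Real_Mod"
begin

section \<open>Large sets of vectors with sparse independence\<close>

text \<open>In coding terms, the vectors of \<open>A\<close> are the columns of a parity check
  matrix over Z/p for a code of minimum distance greater than \<open>K\<close>. Coefficients are
  arbitrary integers whose support is counted modulo \<open>p\<close>, so exponents of characters
  can be inserted directly.\<close>

definition sparse_indep :: "nat \<Rightarrow> nat \<Rightarrow> nat \<Rightarrow> (nat \<Rightarrow> int) set \<Rightarrow> bool" where
  "sparse_indep p n K A \<longleftrightarrow>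
     (\<forall>c. (\<forall>i<n. int p dvd (\<Sum>a\<in>A. c a * a i)) \<and> card {a\<in>A. \<not> int p dvd c a} \<le> K \<longrightarrow>
        (\<forall>a\<in>A. int p dvd c a))"

text \<open>A Chernoff-type count: a coefficient vector with few nonzero entries has weight at least
  \<open>(p * R) powi (-K)\<close> when each nonzero entry weighs \<open>1 / (p * R)\<close>, and the total weight of all
  coefficient vectors factorises.\<close>

lemma card_light_coeffs:
  fixes A :: "'a set"
  assumes "finite A" "card A \<le> R * K" "R \<ge> 1" "p \<ge> 1"
  shows "card {c \<in> PiE A (\<lambda>_. {0..<int p}). card {a\<in>A. c a \<noteq> 0} \<le> K} \<le> (3 * p * R) ^ K"
proof -
  define x :: real where "x = 1 / (real p * real R)"
  have pR: "real p * real R \<ge> 1"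
    using assms(3,4) by (metis One_nat_def mult_le_mono nat_mult_1 of_nat_1 of_nat_le_iff of_nat_mult)
  then have x: "0 < x" "x \<le> 1"
    using assms(3,4) by (simp_all add: x_def)
  have xpR: "x * (real p * real R) = 1"
    using assms(3,4) by (simp add: x_def)
  define wt :: "int \<Rightarrow> real" where "wt = (\<lambda>y. if y = 0 then 1 else x)"
  let ?P = "PiE A (\<lambda>_. {0..<int p})"
  let ?L = "{c \<in> ?P. card {a\<in>A. c a \<noteq> 0} \<le> K}"
  have finP: "finite ?P"
    using assms(1) by (auto intro: finite_PiE)
  have wt_nonneg: "wt y \<ge> 0" for y
    using x by (simp add: wt_def)
  have light: "1 \<le> (real p * real R) ^ K * (\<Prod>a\<in>A. wt (c a))" if "c \<in> ?L" for c
  proof -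
    have "(\<Prod>a\<in>A. wt (c a)) = x ^ card {a\<in>A. c a \<noteq> 0}"
      using assms(1) by (simp add: wt_def prod.If_cases Collect_conj_eq Int_commute Collect_neg_eq)
    also have "\<dots> \<ge> x ^ K"
      using that x by (intro power_decreasing) auto
    finally have "(real p * real R) ^ K * x ^ K \<le> (real p * real R) ^ K * (\<Prod>a\<in>A. wt (c a))"
      by (intro mult_left_mono) auto
    moreover have "(real p * real R) ^ K * x ^ K = 1"
      using xpR by (simp flip: power_mult_distrib add: mult.commute)
    ultimately show ?thesis by simp
  qed
  have sumwt: "(\<Sum>y\<in>{0..<int p}. wt y) \<le> 1 + 1 / real R"
  proof -
    have "{0..<int p} = insert 0 {1..<int p}"
      using assms(4) by auto
    then have "(\<Sum>y\<in>{0..<int p}. wt y) = 1 + (\<Sum>y\<in>{1..<int p}. wt y)"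
      by (simp add: wt_def)
    also have "(\<Sum>y\<in>{1..<int p}. wt y) = (\<Sum>y\<in>{1..<int p}. x)"
      by (intro sum.cong) (auto simp: wt_def)
    also have "\<dots> = (real p - 1) * x"
      using assms(4) by (simp add: of_nat_diff)
    also have "\<dots> \<le> real p * x"
      using x by (intro mult_right_mono) auto
    also have "\<dots> = 1 / real R"
      using assms(3,4) by (simp add: x_def)
    finally show ?thesis by simp
  qed
  have "real (card ?L) = (\<Sum>c\<in>?L. 1)"
    by simp
  also have "\<dots> \<le> (\<Sum>c\<in>?L. (real p * real R) ^ K * (\<Prod>a\<in>A. wt (c a)))"
    by (rule sum_mono) (rule light)
  also have "\<dots> \<le> (\<Sum>c\<in>?P. (real p * real R) ^ K * (\<Prod>a\<in>A. wt (c a)))"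
    using finP wt_nonneg by (intro sum_mono2) (auto intro!: mult_nonneg_nonneg prod_nonneg)
  also have "\<dots> = (real p * real R) ^ K * (\<Prod>a\<in>A. \<Sum>y\<in>{0..<int p}. wt y)"
    using assms(1) by (subst prod_sum_PiE) (auto simp: sum_distrib_left)
  also have "\<dots> = (real p * real R) ^ K * (\<Sum>y\<in>{0..<int p}. wt y) ^ card A"
    by simp
  also have "\<dots> \<le> (real p * real R) ^ K * (1 + 1 / real R) ^ card A"
    using sumwt wt_nonneg by (intro mult_left_mono power_mono sum_nonneg) auto
  also have "\<dots> \<le> (real p * real R) ^ K * (1 + 1 / real R) ^ (R * K)"
    using assms(2) by (intro mult_left_mono power_increasing) auto
  also have "\<dots> \<le> (real p * real R) ^ K * 3 ^ K"
  proof -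
    \<comment> \<open>The constant 3 of the statement arises here, as an upper bound for
      \<open>exp 1\<close>.\<close>
    have "(1 + 1 / real R) ^ R \<le> exp (1 / real R) ^ R"
      by (intro power_mono exp_ge_add_one_self) auto
    also have "\<dots> = exp 1"
      using assms(3) by (simp flip: exp_of_nat_mult)
    also have "\<dots> \<le> 3"
      by (rule exp_le)
    finally have "((1 + 1 / real R) ^ R) ^ K \<le> 3 ^ K"
      by (intro power_mono) auto
    then show ?thesis
      by (intro mult_left_mono) (auto simp: power_mult)
  qed
  also have "\<dots> = real ((3 * p * R) ^ K)"
    by (simp add: power_mult_distrib mult_ac)
  finally show ?thesis
    by (simp only: of_nat_le_iff)
qed

text \<open>A relation in which the coefficient of \<open>x\<close> is prime to \<open>p\<close> can
  be solved for \<open>x\<close>, which \<open>avoid\<close> rules out; any other relation lives on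
  \<open>A\<close> modulo \<open>p\<close>.\<close>

lemma sparse_indep_insert:
  assumes "prime p" "finite A" "x \<notin> A" "sparse_indep p n K A"
    and x: "\<And>i. i < n \<Longrightarrow> x i \<in> {0..<int p}"
    and avoid: "\<And>c. c \<in> PiE A (\<lambda>_. {0..<int p}) \<Longrightarrow> card {a\<in>A. c a \<noteq> 0} \<le> K \<Longrightarrow>
                  \<exists>i<n. x i \<noteq> (\<Sum>a\<in>A. c a * a i) mod int p"
  shows "sparse_indep p n K (insert x A)"
  unfolding sparse_indep_def
proof (intro allI impI, elim conjE)
  fix c
  assume zero: "\<forall>i<n. int p dvd (\<Sum>a\<in>insert x A. c a * a i)"
    and light: "card {a \<in> insert x A. \<not> int p dvd c a} \<le> K"
  have lightA: "card {a\<in>A. \<not> int p dvd c a} \<le> K"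
    by (rule order_trans[OF card_mono light]) (use assms(2) in auto)
  have zero': "int p dvd c x * x i + (\<Sum>a\<in>A. c a * a i)" if "i < n" for i
    using zero that assms(2,3) by simp
  show "\<forall>a\<in>insert x A. int p dvd c a"
  proof (cases "int p dvd c x")
    case True
    then have "int p dvd (\<Sum>a\<in>A. c a * a i)" if "i < n" for i
      using zero'[OF that] by (simp add: dvd_add_right_iff)
    then show ?thesis
      using assms(4) lightA True unfolding sparse_indep_def by blast
  next
    case False
    then have "coprime (c x) (int p)"
      using assms(1) by (simp add: coprime_commute prime_imp_coprime)
    then obtain v where v: "[c x * v = 1] (mod int p)"
      using cong_solve_coprime_int by blast
    \<comment> \<open>Minus the inverse of \<open>c x\<close> modulo \<open>p\<close>: multiplying
      the relation by \<open>u\<close> presents \<open>x\<close> as the combination with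
      coefficients \<open>u * c a\<close>.\<close>
    define u where "u = - v"
    have u: "int p dvd u * c x + 1"
      using v by (simp add: u_def cong_iff_dvd_diff mult.commute dvd_diff_commute)
    define c' where "c' = (\<lambda>a\<in>A. (u * c a) mod int p)"
    have p0: "int p > 0"
      using assms(1) by (simp add: prime_gt_0_nat)
    have "c' \<in> PiE A (\<lambda>_. {0..<int p})"
      using p0 by (auto simp: c'_def)
    moreover have "card {a\<in>A. c' a \<noteq> 0} \<le> K"
      by (rule order_trans[OF card_mono lightA]) (use assms(2) in \<open>auto simp: c'_def\<close>)
    ultimately obtain i where i: "i < n" "x i \<noteq> (\<Sum>a\<in>A. c' a * a i) mod int p"
      using avoid by blast
    have "[(\<Sum>a\<in>A. c' a * a i) = (\<Sum>a\<in>A. u * c a * a i)] (mod int p)"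
      by (intro cong_sum cong_mult) (auto simp: c'_def cong_def)
    also have "(\<Sum>a\<in>A. u * c a * a i) = u * (\<Sum>a\<in>A. c a * a i)"
      by (simp add: sum_distrib_left mult.assoc)
    also have "[u * (\<Sum>a\<in>A. c a * a i) = x i] (mod int p)"
    proof -
      have "u * (\<Sum>a\<in>A. c a * a i) - x i
          = u * (c x * x i + (\<Sum>a\<in>A. c a * a i)) - (u * c x + 1) * x i"
        by (simp add: algebra_simps)
      also have "int p dvd \<dots>"
        using zero'[OF i(1)] u by (intro dvd_diff dvd_mult dvd_mult2)
      finally show ?thesis
        by (simp add: cong_iff_dvd_diff)
    qed
    finally have "(\<Sum>a\<in>A. c' a * a i) mod int p = x i"
      using x[OF i(1)] by (simp add: cong_def)
    with i show ?thesis by simp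
  qed
qed

text \<open>While fewer than \<open>R * K\<close> vectors are chosen, their light combinations
  number at most \<open>(3 * p * R) ^ K\<close> and cannot fill all \<open>p ^ n\<close> vectors, so
  another vector can be added.\<close>

lemma ex_sparse_indep:
  assumes "prime p" "R \<ge> 1" "K \<ge> 1" "(3 * p * R) ^ K < p ^ n" "N \<le> R * K"
  shows "\<exists>A \<subseteq> PiE {..<n} (\<lambda>_. {0..<int p}). finite A \<and> card A = N \<and> sparse_indep p n K A"
  using assms(5)
proof (induction N)
  case 0
  then show ?case
    by (intro exI[of _ "{}"]) (auto simp: sparse_indep_def)
next
  case (Suc N)
  let ?V = "PiE {..<n} (\<lambda>_. {0..<int p})"
  from Suc obtain A where A: "A \<subseteq> ?V" "finite A" "card A = N" "sparse_indep p n K A"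
    by auto
  define L where "L = {c \<in> PiE A (\<lambda>_. {0..<int p}). card {a\<in>A. c a \<noteq> 0} \<le> K}"
  define f where "f = (\<lambda>c. \<lambda>i\<in>{..<n}. (\<Sum>a\<in>A. c a * a i) mod int p)"
  have p1: "p > 1"
    using assms(1) by (rule prime_gt_1_nat)
  have finL: "finite L"
    using A(2) unfolding L_def by (intro finite_subset[OF _ finite_PiE[of A "\<lambda>_. {0..<int p}"]]) auto
  have "card (f ` L) \<le> card L"
    using finL by (rule card_image_le)
  also have "\<dots> \<le> (3 * p * R) ^ K"
    unfolding L_def using A Suc.prems assms(2) p1 by (intro card_light_coeffs) auto
  also have "\<dots> < card ?V"
    using assms(4) by (simp add: card_PiE)
  finally have "\<not> ?V \<subseteq> f ` L"
    using card_mono[of "f ` L" ?V] finL by auto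
  then obtain x where x: "x \<in> ?V" "x \<notin> f ` L"
    by blast
  \<comment> \<open>An element of \<open>A\<close> is itself a light combination with a single
    coefficient 1, as \<open>K \<ge> 1\<close>.\<close>
  have "x \<notin> A"
  proof
    assume xA: "x \<in> A"
    define c :: "(nat \<Rightarrow> int) \<Rightarrow> int" where "c = (\<lambda>a\<in>A. if a = x then 1 else 0)"
    have "{a\<in>A. c a \<noteq> 0} = {x}"
      using xA by (auto simp: c_def)
    then have "c \<in> L"
      using p1 assms(3) by (auto simp: L_def c_def)
    moreover have "f c = x"
    proof
      fix i
      have "(\<Sum>a\<in>A. c a * a i) = (\<Sum>a\<in>A. if a = x then a i else 0)"
        by (intro sum.cong) (auto simp: c_def)
      also have "\<dots> = x i"
        using xA A(2) by simp
      finally show "f c i = x i"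
        using x(1) by (auto simp: f_def PiE_iff extensional_def)
    qed
    ultimately show False
      using x(2) by blast
  qed
  moreover have "sparse_indep p n K (insert x A)"
  proof (rule sparse_indep_insert)
    fix c assume c: "c \<in> PiE A (\<lambda>_. {0..<int p})" "card {a\<in>A. c a \<noteq> 0} \<le> K"
    show "\<exists>i<n. x i \<noteq> (\<Sum>a\<in>A. c a * a i) mod int p"
    proof (rule ccontr)
      assume "\<not> ?thesis"
      then have "f c = x"
        using x(1) by (auto simp: f_def PiE_iff extensional_def fun_eq_iff)
      with c x(2) show False
        by (auto simp: L_def)
    qed
  qed (use A assms \<open>x \<notin> A\<close> x(1) in \<open>auto simp: PiE_iff\<close>)
  ultimately show ?case
    using A x(1) by (intro exI[of _ "insert x A"]) auto
qed

text \<open>With \<open>R = m * L\<close> and \<open>n = L * K\<close> the counting condition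
  reduces to \<open>3 * p * (m * L) < p ^ L\<close>, which is free of \<open>K\<close>. Hence
  \<open>K\<close> can be chosen afterwards, as large as \<open>w\<close> demands.\<close>

lemma ex_block:
  fixes w :: "real \<Rightarrow> real"
  assumes "prime p" "m \<ge> 1" "filterlim w at_top at_top"
  shows "\<exists>K n A. K \<ge> 1 \<and> n \<ge> 1 \<and> A \<subseteq> PiE {..<n} (\<lambda>_. {0..<int p}) \<and> finite A \<and>
           card A = m * n \<and> sparse_indep p n K A \<and> real (card A) \<le> w (real K) * real K"
proof -
  define c where "c = 3 * p * m"
  define L where "L = 4 * c"
  have p2: "p \<ge> 2"
    using assms(1) by (rule prime_ge_2_nat)
  have c: "c \<ge> 1"
    using p2 assms(2) by (simp add: c_def)
  \<comment> \<open>The factor 4 in \<open>L\<close> makes the left side the square of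
    \<open>2 * c\<close>; squaring \<open>2 * c < 2 ^ (2 * c)\<close> then ends exactly at
    \<open>2 ^ L\<close>.\<close>
  have "3 * p * (m * L) = (2 * c)\<^sup>2"
    by (simp add: c_def L_def power2_eq_square)
  also have "\<dots> < (2 ^ (2 * c))\<^sup>2"
    by (intro power_strict_mono less_exp) auto
  also have "\<dots> = 2 ^ L"
    by (simp add: L_def flip: power_mult)
  also have "\<dots> \<le> p ^ L"
    using p2 by (intro power_mono) auto
  finally have L: "3 * p * (m * L) < p ^ L" .
  have "eventually (\<lambda>x. w x \<ge> real (m * L)) at_top"
    using assms(3) by (auto simp: filterlim_at_top)
  then obtain x0 where x0: "\<And>x. x \<ge> x0 \<Longrightarrow> w x \<ge> real (m * L)"
    by (auto simp: eventually_at_top_linorder)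
  obtain K :: nat where K: "real K \<ge> max x0 1"
    using real_arch_simple by blast
  have K1: "K \<ge> 1"
    using K by simp
  have "(3 * p * (m * L)) ^ K < (p ^ L) ^ K"
    using L K1 by (intro power_strict_mono) auto
  then have "(3 * p * (m * L)) ^ K < p ^ (L * K)"
    by (simp add: power_mult)
  moreover have "m * L \<ge> 1"
    using assms(2) c by (simp add: L_def)
  ultimately obtain A where A: "A \<subseteq> PiE {..<L * K} (\<lambda>_. {0..<int p})" "finite A"
    "card A = m * L * K" "sparse_indep p (L * K) K A"
    using ex_sparse_indep[OF assms(1) _ K1, of "m * L" "L * K" "m * L * K"] by auto
  have "real (card A) = real (m * L) * real K"
    using A(3) by simp
  also have "\<dots> \<le> w (real K) * real K"
    using x0[of "real K"] K by (intro mult_right_mono) auto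
  finally show ?thesis
    using A K1 c by (intro exI[of _ K] exI[of _ "L * K"] exI[of _ A]) (auto simp: L_def)
qed

section \<open>Characters and meshes\<close>

text \<open>The standard additive character of Z/p, lifted to the integers so that integer
  combinations can be inserted unreduced.\<close>

definition zexp :: "nat \<Rightarrow> int \<Rightarrow> complex" where
  "zexp p z = cis (2 * pi * real_of_int z / real p)"

lemma zexp_0 [simp]: "zexp p 0 = 1"
  by (simp add: zexp_def)

lemma zexp_add: "zexp p (a + b) = zexp p a * zexp p b"
  by (simp add: zexp_def cis_mult ring_distribs add_divide_distrib)

lemma norm_zexp [simp]: "cmod (zexp p z) = 1"
  by (simp add: zexp_def)

lemma zexp_sum: "zexp p (\<Sum>a\<in>A. f a) = (\<Prod>a\<in>A. zexp p (f a))"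
  by (induction A rule: infinite_finite_induct) (simp_all add: zexp_add)

lemma zexp_powi: "zexp p a powi c = zexp p (c * a)"
  by (simp add: zexp_def cis_power_int mult_ac)

lemma zexp_eq_1_iff:
  assumes "p > 0"
  shows "zexp p z = 1 \<longleftrightarrow> int p dvd z"
proof -
  have "zexp p z = 1 \<longleftrightarrow> (\<exists>n. real_of_int z = real_of_int (int p * n))"
    using assms by (simp add: zexp_def cis_eq_1_iff field_simps)
  then show ?thesis
    unfolding of_int_eq_iff by (auto simp: dvd_def)
qed

lemma zexp_cong:
  assumes "p > 0" "[a = b] (mod int p)"
  shows "zexp p a = zexp p b"
proof -
  have "zexp p a = zexp p (a - b) * zexp p b"
    by (simp flip: zexp_add)
  moreover have "zexp p (a - b) = 1"
    using assms by (simp add: zexp_eq_1_iff cong_iff_dvd_diff)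
  ultimately show ?thesis
    by simp
qed

section \<open>The group \<open>ZpN p\<close> and pointwise evaluation in its dual\<close>

lemma carrier_ZpN:
  assumes "p > 0"
  shows "g \<in> carrier (ZpN p) \<longleftrightarrow> (\<forall>i. 0 \<le> g i \<and> g i < int p)"
  using assms by (auto simp: ZpN_def carrier_integer_mod_group PiE_iff)

lemma mult_ZpN: "g \<otimes>\<^bsub>ZpN p\<^esub> h = (\<lambda>i. (g i + h i) mod int p)"
  by (simp add: ZpN_def fun_eq_iff)

lemma group_ZpN: "group (ZpN p)"
  by (simp add: ZpN_def)

lemma mem_dual_group_iff: "\<gamma> \<in> carrier (dual_group G T) \<longleftrightarrow>
    \<gamma> \<in> extensional (carrier G) \<and> (\<forall>g\<in>carrier G. cmod (\<gamma> g) = 1) \<and>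
    (\<forall>g\<in>carrier G. \<forall>h\<in>carrier G. \<gamma> (g \<otimes>\<^bsub>G\<^esub> h) = \<gamma> g * \<gamma> h) \<and>
    continuous_map T euclidean \<gamma>"
  by (auto simp: dual_group_def hom_def circle_group_def)

abbreviation dual_ZpN :: "nat \<Rightarrow> ((nat \<Rightarrow> int) \<Rightarrow> complex) monoid" where
  "dual_ZpN p \<equiv> dual_group (ZpN p) (ZpN_topology p)"

lemma comm_group_dual_ZpN: "comm_group (dual_ZpN p)"
  by (intro comm_group_dual_group group_ZpN topspace_ZpN_topology)

text \<open>The group has exponent \<open>p\<close>: \<open>h q\<close> is the \<open>q\<close>-fold
  multiple of \<open>g\<close>, and \<open>h p\<close> is the neutral element
  \<open>h 0\<close>.\<close>

lemma dual_ZpN_power_eq_1: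
  assumes "p > 0" "\<gamma> \<in> carrier (dual_ZpN p)" "g \<in> carrier (ZpN p)"
  shows "\<gamma> g ^ p = 1"
proof -
  define h where "h = (\<lambda>q i. (int q * g i) mod int p)"
  have h: "h q \<in> carrier (ZpN p)" for q
    using assms(1) by (simp add: carrier_ZpN h_def)
  have hom: "\<gamma> (a \<otimes>\<^bsub>ZpN p\<^esub> b) = \<gamma> a * \<gamma> b" if "a \<in> carrier (ZpN p)" "b \<in> carrier (ZpN p)" for a b
    using assms(2) that by (auto simp: mem_dual_group_iff)
  \<comment> \<open>Since \<open>h 0\<close> is idempotent, its image is an idempotent nonzero
    number, hence 1.\<close>
  have "h 0 \<otimes>\<^bsub>ZpN p\<^esub> h 0 = h 0"
    by (simp add: mult_ZpN h_def)
  then have "\<gamma> (h 0) = \<gamma> (h 0) * \<gamma> (h 0)"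
    using hom[OF h h, of 0 0] by simp
  moreover have "cmod (\<gamma> (h 0)) = 1"
    using assms(2) h by (auto simp: mem_dual_group_iff)
  then have "\<gamma> (h 0) \<noteq> 0"
    by auto
  ultimately have h0: "\<gamma> (h 0) = 1"
    by simp
  have "\<gamma> (h q) = \<gamma> g ^ q" for q
  proof (induction q)
    case (Suc q)
    have "h (Suc q) = g \<otimes>\<^bsub>ZpN p\<^esub> h q"
      by (simp add: mult_ZpN h_def fun_eq_iff mod_add_right_eq ring_distribs)
    then show ?case
      using hom[OF assms(3) h] Suc by simp
  qed (simp add: h0)
  moreover have "h p = h 0"
    by (simp add: h_def)
  ultimately show ?thesis
    using h0 by metis
qed

lemma dual_group_mult_apply: "g \<in> carrier G \<Longrightarrow> (\<gamma> \<otimes>\<^bsub>dual_group G T\<^esub> \<delta>) g = \<gamma> g * \<delta> g"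
  by (simp add: dual_group_def)

lemma dual_group_one_apply: "g \<in> carrier G \<Longrightarrow> \<one>\<^bsub>dual_group G T\<^esub> g = 1"
  by (simp add: dual_group_def)

text \<open>Together with \<open>dual_group_finprod_apply\<close> this replaces computations in the
  abstract dual by computations with complex numbers.\<close>

lemma dual_group_int_pow_apply:
  assumes "group G" "topspace T = carrier G" "\<gamma> \<in> carrier (dual_group G T)" "g \<in> carrier G"
  shows "(\<gamma> [^]\<^bsub>dual_group G T\<^esub> (n :: int)) g = \<gamma> g powi n"
proof -
  interpret D: comm_group "dual_group G T"
    using assms(1,2) by (rule comm_group_dual_group)
  have pow: "(\<gamma> [^]\<^bsub>dual_group G T\<^esub> (m :: nat)) g = \<gamma> g ^ m" for m
    by (induction m) (use assms(4) in \<open>simp_all add: dual_group_mult_apply dual_group_one_apply\<close>)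
  have inv: "(inv\<^bsub>dual_group G T\<^esub> \<delta>) g = inverse (\<delta> g)" if "\<delta> \<in> carrier (dual_group G T)" for \<delta>
  proof -
    have "\<delta> g * (inv\<^bsub>dual_group G T\<^esub> \<delta>) g = 1"
      using dual_group_mult_apply[OF assms(4), of T \<delta> "inv\<^bsub>dual_group G T\<^esub> \<delta>"] that assms(4)
      by (simp add: dual_group_one_apply)
    then show ?thesis
      by (metis inverse_unique)
  qed
  show ?thesis
  proof (cases "n < 0")
    case True
    then have "\<gamma> [^]\<^bsub>dual_group G T\<^esub> n = inv\<^bsub>dual_group G T\<^esub> (\<gamma> [^]\<^bsub>dual_group G T\<^esub> nat (- n))"
      by (subst int_pow_def2) (rule if_P)
    then have "(\<gamma> [^]\<^bsub>dual_group G T\<^esub> n) g = inverse (\<gamma> g ^ nat (- n))"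
      using inv[OF D.nat_pow_closed[OF assms(3)]] pow by metis
    also have "\<dots> = \<gamma> g powi n"
      using True by (simp add: power_int_def power_inverse)
    finally show ?thesis .
  next
    case False
    then have "\<gamma> [^]\<^bsub>dual_group G T\<^esub> n = \<gamma> [^]\<^bsub>dual_group G T\<^esub> nat n"
      by (subst int_pow_def2) (rule if_not_P)
    then show ?thesis
      using False pow[of "nat n"] by (simp add: power_int_def)
  qed
qed

lemma dual_group_finprod_apply:
  assumes "group G" "topspace T = carrier G" "f \<in> J \<rightarrow> carrier (dual_group G T)"
    and "finite J" "g \<in> carrier G"
  shows "finprod (dual_group G T) f J g = (\<Prod>j\<in>J. f j g)"
proof -
  interpret D: comm_group "dual_group G T"
    using assms(1,2) by (rule comm_group_dual_group)
  show ?thesis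
    using assms(4,3)
    by (induction J rule: finite_induct)
       (use assms(5) in \<open>simp_all add: dual_group_mult_apply dual_group_one_apply\<close>)
qed

section \<open>Meshes and the independent characters they contain\<close>

text \<open>The exponent set of the mesh is dropped; what is kept is that its elements are pointwise
  products of powers of \<open>k\<close> fixed characters.\<close>

lemma mesh_apply:
  assumes "is_mesh (dual_ZpN p) k M"
  obtains \<gamma> where "\<gamma> \<in> {1..k} \<rightarrow> carrier (dual_ZpN p)"
    and "\<And>\<psi>. \<psi> \<in> M \<Longrightarrow> \<exists>n. \<forall>g\<in>carrier (ZpN p). \<psi> g = (\<Prod>j\<in>{1..k}. \<gamma> j g powi n j)"
proof -
  interpret D: comm_group "dual_ZpN p"
    by (rule comm_group_dual_ZpN)
  obtain \<gamma> E where \<gamma>: "\<gamma> \<in> {1..k} \<rightarrow> carrier (dual_ZpN p)"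
    and M: "M = {finprod (dual_ZpN p) (\<lambda>j. \<gamma> j [^]\<^bsub>dual_ZpN p\<^esub> n j) {1..k} | n :: nat \<Rightarrow> int. n \<in> E}"
    using assms unfolding is_mesh_def by blast
  have "finprod (dual_ZpN p) (\<lambda>j. \<gamma> j [^]\<^bsub>dual_ZpN p\<^esub> n j) {1..k} g = (\<Prod>j\<in>{1..k}. \<gamma> j g powi n j)"
    if "g \<in> carrier (ZpN p)" for n :: "nat \<Rightarrow> int" and g
  proof -
    have "finprod (dual_ZpN p) (\<lambda>j. \<gamma> j [^]\<^bsub>dual_ZpN p\<^esub> n j) {1..k} g
        = (\<Prod>j\<in>{1..k}. (\<gamma> j [^]\<^bsub>dual_ZpN p\<^esub> n j) g)"
      using \<gamma> that by (intro dual_group_finprod_apply group_ZpN topspace_ZpN_topology) auto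
    also have "\<dots> = (\<Prod>j\<in>{1..k}. \<gamma> j g powi n j)"
      using \<gamma> that
      by (intro prod.cong refl dual_group_int_pow_apply group_ZpN topspace_ZpN_topology) auto
    finally show ?thesis .
  qed
  with \<gamma> M that show thesis
    by blast
qed

lemma prod_power_int:
  fixes f :: "'a \<Rightarrow> 'b :: field"
  shows "(\<Prod>j\<in>J. f j) powi n = (\<Prod>j\<in>J. f j powi n)"
  by (induction J rule: infinite_finite_induct) (simp_all add: power_int_mult_distrib)

lemma power_int_sum:
  fixes z :: "'a :: field"
  assumes "z \<noteq> 0"
  shows "z powi (\<Sum>b\<in>B. f b) = (\<Prod>b\<in>B. z powi f b)"
  by (induction B rule: infinite_finite_induct) (simp_all add: assms power_int_add)

lemma powi_mod_eq:
  fixes z :: "'a :: field"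
  assumes "z ^ p = 1" "p > 0"
  shows "z powi (n mod int p) = z powi n"
proof -
  have "z \<noteq> 0"
    using assms by (auto simp: power_0_left)
  then have "z powi n = z powi (int p * (n div int p)) * z powi (n mod int p)"
    by (simp flip: power_int_add)
  also have "z powi (int p * (n div int p)) = 1"
    using assms by (simp add: power_int_mult)
  finally show ?thesis
    by simp
qed

text \<open>Independent characters \<open>\<psi> b\<close>, for \<open>b \<in> B\<close>, generate a group of order \<open>p ^ card B\<close>,
  whereas a mesh on \<open>k\<close> characters lies in a group of order at most \<open>p ^ k\<close>.\<close>

lemma card_indep_in_mesh_le:
  assumes "prime p" "finite B" "\<gamma> \<in> {1..k} \<rightarrow> carrier (dual_ZpN p)"
    and \<psi>: "\<And>b. b \<in> B \<Longrightarrow> \<exists>n. \<forall>g\<in>carrier (ZpN p). \<psi> b g = (\<Prod>j\<in>{1..k}. \<gamma> j g powi n j)"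
    and indep: "\<And>c. (\<And>g. g \<in> carrier (ZpN p) \<Longrightarrow> (\<Prod>b\<in>B. \<psi> b g powi c b) = 1) \<Longrightarrow>
                  \<forall>b\<in>B. int p dvd c b"
  shows "card B \<le> k"
proof -
  have p1: "p > 1"
    using assms(1) by (rule prime_gt_1_nat)
  obtain n where n: "\<And>b g. b \<in> B \<Longrightarrow> g \<in> carrier (ZpN p) \<Longrightarrow>
      \<psi> b g = (\<Prod>j\<in>{1..k}. \<gamma> j g powi n b j)"
    using \<psi> by metis
  \<comment> \<open>\<open>\<Phi>\<close> converts exponents over \<open>B\<close> into exponents
    over the generators, reduced modulo \<open>p\<close>; \<open>eval\<close> shows that the
    reduction leaves the character unchanged.\<close>
  define \<Phi> where "\<Phi> = (\<lambda>c. \<lambda>j\<in>{1..k}. (\<Sum>b\<in>B. c b * n b j) mod int p)"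
  let ?P = "PiE B (\<lambda>_. {0..<int p})" and ?Q = "PiE {1..k} (\<lambda>_. {0..<int p})"
  have \<gamma>_nz: "\<gamma> j g \<noteq> 0" if "g \<in> carrier (ZpN p)" "j \<in> {1..k}" for j g
  proof -
    have "\<gamma> j \<in> carrier (dual_ZpN p)"
      using assms(3) that(2) by auto
    then have "cmod (\<gamma> j g) = 1"
      using that(1) by (simp add: mem_dual_group_iff)
    then show ?thesis
      by auto
  qed
  have eval: "(\<Prod>b\<in>B. \<psi> b g powi c b) = (\<Prod>j\<in>{1..k}. \<gamma> j g powi \<Phi> c j)"
    if g: "g \<in> carrier (ZpN p)" for c g
  proof -
    have "(\<Prod>b\<in>B. \<psi> b g powi c b) = (\<Prod>b\<in>B. \<Prod>j\<in>{1..k}. \<gamma> j g powi (c b * n b j))"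
    proof (intro prod.cong refl)
      fix b assume "b \<in> B"
      then show "\<psi> b g powi c b = (\<Prod>j\<in>{1..k}. \<gamma> j g powi (c b * n b j))"
        using n g by (simp add: prod_power_int power_int_mult mult.commute[of "c b"])
    qed
    also have "\<dots> = (\<Prod>j\<in>{1..k}. \<Prod>b\<in>B. \<gamma> j g powi (c b * n b j))"
      by (rule prod.swap)
    also have "\<dots> = (\<Prod>j\<in>{1..k}. \<gamma> j g powi (\<Sum>b\<in>B. c b * n b j))"
      using \<gamma>_nz[OF g] by (intro prod.cong refl) (simp add: power_int_sum)
    also have "\<dots> = (\<Prod>j\<in>{1..k}. \<gamma> j g powi \<Phi> c j)"
    proof (intro prod.cong refl)
      fix j assume j: "j \<in> {1..k}"
      then have "\<gamma> j g ^ p = 1"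
        using assms(3) g p1 by (intro dual_ZpN_power_eq_1) auto
      then show "\<gamma> j g powi (\<Sum>b\<in>B. c b * n b j) = \<gamma> j g powi \<Phi> c j"
        using j p1 by (simp add: \<Phi>_def powi_mod_eq)
    qed
    finally show ?thesis .
  qed
  have \<psi>_nz: "\<psi> b g \<noteq> 0" if "b \<in> B" "g \<in> carrier (ZpN p)" for b g
    using n[OF that] \<gamma>_nz[OF that(2)] by simp
  \<comment> \<open>Equal images turn \<open>c - d\<close> into a relation, so its entries are
    divisible by \<open>p\<close>; as the entries of \<open>c\<close> and \<open>d\<close> lie in
    \<open>{0..<int p}\<close>, they agree.\<close>
  have "inj_on \<Phi> ?P"
  proof (rule inj_onI)
    fix c d assume cd: "c \<in> ?P" "d \<in> ?P" "\<Phi> c = \<Phi> d"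
    have "(\<Prod>b\<in>B. \<psi> b g powi (c b - d b)) = 1" if g: "g \<in> carrier (ZpN p)" for g
    proof -
      have nz: "(\<Prod>b\<in>B. \<psi> b g powi d b) \<noteq> 0"
        using \<psi>_nz[OF _ g] assms(2) by simp
      have "(\<Prod>b\<in>B. \<psi> b g powi (c b - d b)) = (\<Prod>b\<in>B. \<psi> b g powi c b / \<psi> b g powi d b)"
        using \<psi>_nz g by (intro prod.cong refl power_int_diff) auto
      also have "\<dots> = (\<Prod>b\<in>B. \<psi> b g powi c b) / (\<Prod>b\<in>B. \<psi> b g powi d b)"
        by (rule prod_dividef)
      also have "\<dots> = 1"
        using eval[OF g, of c] eval[OF g, of d] cd(3) nz by simp
      finally show ?thesis .
    qed
    from indep[OF this] have dvd: "\<forall>b\<in>B. int p dvd c b - d b"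
      by blast
    show "c = d"
    proof (rule PiE_ext[OF cd(1,2)])
      fix b assume b: "b \<in> B"
      then have "[c b = d b] (mod int p)"
        using dvd by (simp add: cong_iff_dvd_diff)
      moreover have "c b \<in> {0..<int p}" "d b \<in> {0..<int p}"
        using cd b by auto
      ultimately show "c b = d b"
        by (simp add: cong_def)
    qed
  qed
  moreover have "\<Phi> ` ?P \<subseteq> ?Q"
    using p1 by (auto simp: \<Phi>_def)
  ultimately have "card ?P \<le> card ?Q"
    by (intro card_inj_on_le) (auto intro: finite_PiE)
  then have "p ^ card B \<le> p ^ k"
    using assms(2) by (simp add: card_PiE)
  then show ?thesis
    using p1 by simp
qed

section \<open>Characters attached to blocks of coordinates\<close>

text \<open>Via \<open>prod_encode\<close>, the factors of \<open>ZpN p\<close> are arranged in infinitely many infinite blocks;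
  the character below uses the first \<open>n\<close> factors of block \<open>m\<close>.\<close>

definition block_char :: "nat \<Rightarrow> nat \<Rightarrow> nat \<Rightarrow> (nat \<Rightarrow> int) \<Rightarrow> (nat \<Rightarrow> int) \<Rightarrow> complex" where
  "block_char p n m v = (\<lambda>g\<in>carrier (ZpN p). zexp p (\<Sum>i<n. v i * g (prod_encode (m, i))))"

lemma block_char_in_dual:
  assumes "p > 0"
  shows "block_char p n m v \<in> carrier (dual_ZpN p)"
  unfolding mem_dual_group_iff
proof (intro conjI ballI)
  show "block_char p n m v \<in> extensional (carrier (ZpN p))"
    by (simp add: block_char_def)
  show "cmod (block_char p n m v g) = 1" if "g \<in> carrier (ZpN p)" for g
    using that by (simp add: block_char_def)
  show "block_char p n m v (g \<otimes>\<^bsub>ZpN p\<^esub> h) = block_char p n m v g * block_char p n m v h"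
    if gh: "g \<in> carrier (ZpN p)" "h \<in> carrier (ZpN p)" for g h
  proof -
    have "g \<otimes>\<^bsub>ZpN p\<^esub> h \<in> carrier (ZpN p)"
      using assms by (simp add: carrier_ZpN mult_ZpN)
    \<comment> \<open>The group law reduces coordinates modulo \<open>p\<close>, which
      \<open>zexp\<close> does not detect.\<close>
    moreover have "zexp p (\<Sum>i<n. v i * (g \<otimes>\<^bsub>ZpN p\<^esub> h) (prod_encode (m, i)))
        = zexp p (\<Sum>i<n. v i * (g (prod_encode (m, i)) + h (prod_encode (m, i))))"
      by (intro zexp_cong assms cong_sum cong_mult) (simp_all add: mult_ZpN)
    ultimately show ?thesis
      using gh by (simp add: block_char_def ring_distribs sum.distrib zexp_add)
  qed
  \<comment> \<open>Only finitely many coordinates enter, each with values in a discrete space.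
    Writing the phase as a real sum lets continuity follow by composition.\<close>
  have "continuous_map (ZpN_topology p) euclidean
      (\<lambda>g. cis (2 * pi * (\<Sum>i<n. real_of_int (v i * g (prod_encode (m, i)))) / real p))"
  proof -
    have coord: "continuous_map (ZpN_topology p) euclideanreal (\<lambda>g. real_of_int (v i * g j))" for i j
    proof -
      have "continuous_map (ZpN_topology p)
          (discrete_topology (carrier (integer_mod_group p))) (\<lambda>g. g j)"
        unfolding ZpN_topology_def by (intro continuous_map_product_projection) simp
      moreover have "continuous_map (discrete_topology (carrier (integer_mod_group p)))
          euclideanreal (\<lambda>y. real_of_int (v i * y))"
        by simp
      ultimately show ?thesis
        by (rule continuous_map_compose[unfolded o_def])
    qed
    have "continuous_map (ZpN_topology p) euclideanreal
        (\<lambda>g. \<Sum>i<n. real_of_int (v i * g (prod_encode (m, i))))"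
      by (intro continuous_map_sum coord) simp
    moreover have "continuous_map euclideanreal euclidean (\<lambda>t. cis (2 * pi * t / real p))"
      using assms unfolding continuous_map_iff_continuous2 by (intro continuous_intros) auto
    ultimately show ?thesis
      by (rule continuous_map_compose[unfolded o_def])
  qed
  then show "continuous_map (ZpN_topology p) euclidean (block_char p n m v)"
    by (rule continuous_map_eq)
       (simp add: topspace_ZpN_topology block_char_def zexp_def)
qed

definition unit_ZpN :: "nat \<Rightarrow> nat \<Rightarrow> int" where
  "unit_ZpN j = (\<lambda>i. if i = j then 1 else 0)"

lemma unit_ZpN_carrier: "p > 1 \<Longrightarrow> unit_ZpN j \<in> carrier (ZpN p)"
  by (simp add: carrier_ZpN unit_ZpN_def)

text \<open>Coordinate vectors read off the entries of \<open>v\<close> modulo \<open>p\<close> and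
  are invisible to the characters of other blocks.\<close>

lemma block_char_unit:
  assumes "p > 1" "i < n"
  shows "block_char p n m v (unit_ZpN (prod_encode (m', i))) = (if m = m' then zexp p (v i) else 1)"
proof -
  have "(\<Sum>i'<n. v i' * unit_ZpN (prod_encode (m', i)) (prod_encode (m, i')))
      = (\<Sum>i'<n. if i' = i then (if m = m' then v i else 0) else 0)"
    by (intro sum.cong) (auto simp: unit_ZpN_def)
  then show ?thesis
    using assms by (simp add: block_char_def unit_ZpN_carrier)
qed

lemma inj_on_block_char:
  assumes "p > 1"
  shows "inj_on (block_char p n m) (PiE {..<n} (\<lambda>_. {0..<int p}))"
proof (rule inj_onI)
  fix v w assume vw: "v \<in> PiE {..<n} (\<lambda>_. {0..<int p})" "w \<in> PiE {..<n} (\<lambda>_. {0..<int p})"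
    and eq: "block_char p n m v = block_char p n m w"
  show "v = w"
  proof (rule PiE_ext[OF vw])
    fix i assume i: "i \<in> {..<n}"
    then have "zexp p (v i) = zexp p (w i)"
      using assms block_char_unit[of p i n m v m] block_char_unit[of p i n m w m] eq by simp
    then have "zexp p (v i - w i) = 1"
      using zexp_add[of p "v i - w i" "w i"] norm_zexp[of p "w i"]
      by (metis diff_add_cancel mult_cancel_right1 norm_zero zero_neq_one)
    then have "[v i = w i] (mod int p)"
      using assms by (simp add: zexp_eq_1_iff cong_iff_dvd_diff)
    moreover have "v i \<in> {0..<int p}" "w i \<in> {0..<int p}"
      using PiE_mem[OF vw(1) i] PiE_mem[OF vw(2) i] by blast+
    ultimately show "v i = w i"
      by (simp add: cong_def)
  qed
qed

text \<open>Evaluating the relation at the coordinate vectors of block \<open>m\<close> removes all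
  other blocks and leaves a relation over \<open>A m\<close> with at most \<open>K m\<close> nonzero
  coefficients.\<close>

lemma block_chars_indep:
  assumes "p > 1" "finite B" "\<And>m. finite (A m)" "B \<subseteq> Sigma UNIV A"
    and indep: "\<And>m. sparse_indep p (n m) (K m) (A m)"
    and few: "\<And>m. card {v. (m, v) \<in> B} \<le> K m"
    and one: "\<And>g. g \<in> carrier (ZpN p) \<Longrightarrow>
                (\<Prod>(m, v)\<in>B. block_char p (n m) m v g powi c (m, v)) = 1"
  shows "\<forall>b\<in>B. int p dvd c b"
proof (clarify)
  fix m v assume mv: "(m, v) \<in> B"
  \<comment> \<open>Extension by zero outside \<open>B\<close>, since \<open>sparse_indep\<close>
    speaks of relations over all of \<open>A m\<close>.\<close>
  define d where "d = (\<lambda>w. if (m, w) \<in> B then c (m, w) else 0)"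
  have sub: "{w. (m, w) \<in> B} \<subseteq> A m"
    using assms(4) by auto
  have "int p dvd (\<Sum>w\<in>A m. d w * w i)" if i: "i < n m" for i
  proof -
    let ?g = "unit_ZpN (prod_encode (m, i))"
    let ?S = "Pair m ` {w. (m, w) \<in> B}"
    have val: "block_char p (n m') m' w ?g powi c (m', w)
        = (if m' = m then zexp p (c (m, w) * w i) else 1)" for m' w
    proof (cases "m' = m")
      case True
      then show ?thesis
        using block_char_unit[OF assms(1) i, of m w m] by (simp add: zexp_powi)
    next
      case False
      \<comment> \<open>Computed directly: \<open>block_char_unit\<close> would ask for
        \<open>i < n m'\<close>, while only \<open>i < n m\<close> is known.\<close>
      have "(\<Sum>i'<n m'. w i' * ?g (prod_encode (m', i'))) = 0"
        using False by (intro sum.neutral) (simp add: unit_ZpN_def)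
      then show ?thesis
        using False assms(1) by (simp add: block_char_def unit_ZpN_carrier)
    qed
    have "1 = (\<Prod>(m', w)\<in>B. block_char p (n m') m' w ?g powi c (m', w))"
      using one[OF unit_ZpN_carrier[OF assms(1)]] by simp
    also have "\<dots> = (\<Prod>(m', w)\<in>B. if m' = m then zexp p (c (m, w) * w i) else 1)"
      by (simp add: val)
    also have "\<dots> = (\<Prod>(m', w)\<in>?S. if m' = m then zexp p (c (m, w) * w i) else 1)"
      using assms(2) by (intro prod.mono_neutral_right) auto
    also have "\<dots> = (\<Prod>w\<in>{w. (m, w) \<in> B}. zexp p (c (m, w) * w i))"
      by (subst prod.reindex) (auto simp: inj_on_def)
    also have "\<dots> = (\<Prod>w\<in>A m. zexp p (d w * w i))"
      using sub assms(3) by (intro prod.mono_neutral_cong_left) (auto simp: d_def)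
    also have "\<dots> = zexp p (\<Sum>w\<in>A m. d w * w i)"
      by (simp add: zexp_sum)
    finally show ?thesis
      using assms(1) by (simp add: zexp_eq_1_iff)
  qed
  moreover have "card {w \<in> A m. \<not> int p dvd d w} \<le> K m"
    by (rule order_trans[OF card_mono few])
       (use finite_subset[OF sub assms(3)] in \<open>auto simp: d_def\<close>)
  ultimately have "\<forall>w\<in>A m. int p dvd d w"
    using indep[of m] unfolding sparse_indep_def by blast
  then show "int p dvd c (m, v)"
    using mv sub by (auto simp: d_def split: if_splits)
qed

text \<open>The count runs over finite sets \<open>T\<close> of index pairs because finiteness of
  the intersection with the mesh is itself going to be derived from this bound.\<close>

lemma card_chars_in_mesh_le:
  fixes w :: "real \<Rightarrow> real"
  assumes "prime p" "mono_on {1..} w" "\<And>x. x \<ge> 1 \<Longrightarrow> w x \<ge> 1"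
    and A: "\<And>m. finite (A m)" "\<And>m. sparse_indep p (n m) (K m) (A m)" "\<And>m. K m \<ge> 1"
      "\<And>m. real (card (A m)) \<le> w (real (K m)) * real (K m)"
    and "k \<ge> 1" "is_mesh (dual_ZpN p) k M"
    and T: "finite T" "T \<subseteq> Sigma UNIV A" "\<And>m v. (m, v) \<in> T \<Longrightarrow> block_char p (n m) m v \<in> M"
  shows "real (card T) \<le> real k * w (real k)"
proof -
  obtain \<gamma> where \<gamma>: "\<gamma> \<in> {1..k} \<rightarrow> carrier (dual_ZpN p)"
    "\<And>\<psi>. \<psi> \<in> M \<Longrightarrow> \<exists>n. \<forall>g\<in>carrier (ZpN p). \<psi> g = (\<Prod>j\<in>{1..k}. \<gamma> j g powi n j)"
    using mesh_apply[OF assms(9)] by metis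
  define U where "U = (\<lambda>m. {v. (m, v) \<in> T})"
  have U: "U m \<subseteq> A m" for m
    using T(2) by (auto simp: U_def)
  have finU: "finite (U m)" for m
    using finite_subset[OF U A(1)] .
  \<comment> \<open>From each block as many elements are taken as sparse independence
    controls.\<close>
  have "\<exists>S. S \<subseteq> U m \<and> card S = min (card (U m)) (K m)" for m
    using obtain_subset_with_card_n[of "min (card (U m)) (K m)" "U m"] by (metis min.cobounded1)
  then obtain S where S: "\<And>m. S m \<subseteq> U m" "\<And>m. card (S m) = min (card (U m)) (K m)"
    by metis
  have finS: "finite (S m)" for m
    using finite_subset[OF S(1) finU] .
  define I where "I = fst ` T"
  have finI: "finite I"
    using T(1) by (simp add: I_def)
  define B where "B = Sigma I S"
  have BT: "B \<subseteq> T"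
    using S(1) by (auto simp: B_def U_def)
  have finB: "finite B"
    using finite_subset[OF BT T(1)] .
  have cardB: "card B = (\<Sum>m\<in>I. card (S m))"
    using finI finS by (simp add: B_def)
  have "card B \<le> k"
  proof (rule card_indep_in_mesh_le[OF assms(1) finB \<gamma>(1),
        where \<psi> = "\<lambda>(m, v). block_char p (n m) m v"])
    fix b assume "b \<in> B"
    then show "\<exists>n'. \<forall>g\<in>carrier (ZpN p).
        (case b of (m, v) \<Rightarrow> block_char p (n m) m v) g = (\<Prod>j\<in>{1..k}. \<gamma> j g powi n' j)"
      using BT T(3) \<gamma>(2) by (cases b) (simp add: subset_iff)
  next
    fix c
    assume one: "\<And>g. g \<in> carrier (ZpN p) \<Longrightarrow>
      (\<Prod>b\<in>B. (case b of (m, v) \<Rightarrow> block_char p (n m) m v) g powi c b) = 1"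
    show "\<forall>b\<in>B. int p dvd c b"
    proof (rule block_chars_indep[OF prime_gt_1_nat[OF assms(1)] finB A(1) _ A(2)])
      show "B \<subseteq> Sigma UNIV A"
        using BT T(2) by blast
      show "card {v. (m, v) \<in> B} \<le> K m" for m
      proof -
        have "card {v. (m, v) \<in> B} \<le> card (S m)"
          using finS by (intro card_mono) (auto simp: B_def)
        then show ?thesis
          using S(2)[of m] by simp
      qed
      show "(\<Prod>(m, v)\<in>B. block_char p (n m) m v g powi c (m, v)) = 1"
        if "g \<in> carrier (ZpN p)" for g
        using one[OF that] by (simp add: case_prod_unfold)
    qed
  qed
  have w_k: "w (real k) \<ge> 1"
    using assms(3,8) by simp
  \<comment> \<open>If \<open>U m\<close> has at most \<open>K m\<close> elements,
    \<open>S m\<close> is equally large and \<open>w (real k) \<ge> 1\<close> suffices. Otherwise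
    \<open>S m\<close> has \<open>K m\<close> elements, which forces \<open>K m \<le> k\<close>, and
    monotonicity of \<open>w\<close> applies.\<close>
  have block: "real (card (U m)) \<le> w (real k) * real (card (S m))" if m: "m \<in> I" for m
  proof (cases "card (U m) \<le> K m")
    case True
    then show ?thesis
      using S(2)[of m] w_k by (simp add: mult_right_mono[of 1 "w (real k)" "real (card (U m))", simplified])
  next
    case False
    then have SK: "card (S m) = K m"
      using S(2)[of m] by simp
    have "card (S m) \<le> card B"
      unfolding cardB using finI m by (intro member_le_sum) auto
    then have "K m \<le> k"
      using \<open>card B \<le> k\<close> SK by simp
    have "real (card (U m)) \<le> real (card (A m))"
      using U A(1) by (simp add: card_mono)
    also have "\<dots> \<le> w (real (K m)) * real (K m)"
      by (rule A(4))
    also have "\<dots> \<le> w (real k) * real (K m)"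
      using \<open>K m \<le> k\<close> A(3)[of m] assms(2) by (intro mult_right_mono) (auto simp: mono_on_def)
    finally show ?thesis
      using SK by simp
  qed
  have "T = Sigma I U"
    by (force simp: I_def U_def)
  then have "real (card T) = (\<Sum>m\<in>I. real (card (U m)))"
    using finI finU by simp
  also have "\<dots> \<le> (\<Sum>m\<in>I. w (real k) * real (card (S m)))"
    by (intro sum_mono block)
  also have "\<dots> = w (real k) * real (card B)"
    by (simp add: cardB sum_distrib_left)
  also have "\<dots> \<le> w (real k) * real k"
    using \<open>card B \<le> k\<close> w_k by (intro mult_left_mono) auto
  finally show ?thesis
    by (simp add: mult.commute)
qed

section \<open>Small polynomials by choice of signs\<close>

text \<open>As \<open>(1 + l) * (1 - l + l\<^sup>2) = 1 + l ^ 3\<close>, the bound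
  \<open>exp (-l) \<le> 1 / (1 + l)\<close> gives \<open>exp (-l) \<le> 1 - l + l\<^sup>2\<close>.
  Averaging with \<open>exp l \<le> 1 + l + l\<^sup>2\<close> yields
  \<open>1 + l\<^sup>2\<close>.\<close>

lemma cosh_le_exp_square:
  fixes l :: real
  assumes "0 \<le> l" "l \<le> 1"
  shows "cosh l \<le> exp (l\<^sup>2)"
proof -
  have "exp (-l) \<le> 1 - l + l\<^sup>2"
  proof -
    have "(1 + l) * exp (-l) \<le> exp l * exp (-l)"
      by (intro mult_right_mono exp_ge_add_one_self) auto
    then have "(1 + l) * exp (-l) \<le> 1"
      by (simp flip: exp_add)
    also have "1 \<le> (1 + l) * (1 - l + l\<^sup>2)"
      using assms(1) by (simp add: algebra_simps power2_eq_square)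
    finally show ?thesis
      using assms(1) by simp
  qed
  then have "cosh l \<le> 1 + l\<^sup>2"
    using exp_bound[OF assms] by (simp add: cosh_field_def)
  also have "\<dots> \<le> exp (l\<^sup>2)"
    by (rule exp_ge_add_one_self)
  finally show ?thesis .
qed

text \<open>Choosing the signs one at a time: averaging over the next sign multiplies the potential
  by at most \<open>cosh l\<close>, as \<open>cosh (u + v) + cosh (u - v) = 2 * cosh u * cosh v\<close>.\<close>

lemma ex_signs_cosh_sum_le:
  fixes u :: "'a \<Rightarrow> 'b \<Rightarrow> real"
  assumes "finite F" "finite X" "l \<ge> 0" "\<And>a x. a \<in> F \<Longrightarrow> x \<in> X \<Longrightarrow> \<bar>u a x\<bar> \<le> 1"
  shows "\<exists>e. (\<forall>a. e a = 1 \<or> e a = -1) \<and>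
           (\<Sum>x\<in>X. cosh (l * (\<Sum>a\<in>F. e a * u a x))) \<le> real (card X) * cosh l ^ card F"
  using assms(1,4)
proof (induction F rule: finite_induct)
  case empty
  then show ?case
    by (intro exI[of _ "\<lambda>_. 1"]) simp
next
  case (insert b F)
  then obtain e where e: "\<forall>a. e a = 1 \<or> e a = -1"
    "(\<Sum>x\<in>X. cosh (l * (\<Sum>a\<in>F. e a * u a x))) \<le> real (card X) * cosh l ^ card F"
    by auto
  let ?s = "\<lambda>x. \<Sum>a\<in>F. e a * u a x"
  have s: "(\<Sum>a\<in>insert b F. (e(b := r)) a * u a x) = r * u b x + ?s x" for r x
  proof -
    have "(\<Sum>a\<in>F. (e(b := r)) a * u a x) = ?s x"
      using insert.hyps by (intro sum.cong) auto
    then show ?thesis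
      using insert.hyps by simp
  qed
  let ?f = "\<lambda>r. \<Sum>x\<in>X. cosh (l * (\<Sum>a\<in>insert b F. (e(b := r)) a * u a x))"
  have "?f 1 + ?f (-1) = (\<Sum>x\<in>X. 2 * (cosh (l * u b x) * cosh (l * ?s x)))"
    unfolding s sum.distrib[symmetric]
    by (intro sum.cong refl)
       (simp add: ring_distribs cosh_add cosh_diff flip: add_uminus_conv_diff del: add_uminus_conv_diff)
  also have "\<dots> \<le> (\<Sum>x\<in>X. 2 * (cosh l * cosh (l * ?s x)))"
  proof (intro sum_mono mult_left_mono mult_right_mono)
    fix x assume "x \<in> X"
    then have "\<bar>u b x\<bar> \<le> 1"
      using insert.prems by auto
    then have "\<bar>l * u b x\<bar> \<le> l"
      using assms(3) by (simp add: abs_mult mult_left_le)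
    then have "cosh \<bar>l * u b x\<bar> \<le> cosh l"
      using assms(3) by (subst cosh_real_nonneg_le_iff) auto
    then show "cosh (l * u b x) \<le> cosh l"
      by simp
  qed auto
  also have "\<dots> = 2 * cosh l * (\<Sum>x\<in>X. cosh (l * ?s x))"
    by (simp add: sum_distrib_left mult_ac)
  also have "\<dots> \<le> 2 * cosh l * (real (card X) * cosh l ^ card F)"
    using e(2) by (intro mult_left_mono) auto
  also have "\<dots> = 2 * (real (card X) * cosh l ^ card (insert b F))"
    using insert.hyps by simp
  \<comment> \<open>Two numbers whose sum is at most twice the bound: one of the two signs must meet
    it.\<close>
  finally have "?f 1 \<le> real (card X) * cosh l ^ card (insert b F) \<or>
      ?f (-1) \<le> real (card X) * cosh l ^ card (insert b F)"
    by linarith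
  then obtain r where "r = 1 \<or> r = -1" "?f r \<le> real (card X) * cosh l ^ card (insert b F)"
    by blast
  then show ?case
    using e(1) by (intro exI[of _ "e(b := r)"]) auto
qed

text \<open>A Chernoff bound: each term of the potential is at most the total, and logarithms
  divided by \<open>l\<close> bound the sums. Real and imaginary parts count as separate points,
  whence the outer factor 2.\<close>

lemma ex_signs_cmod_le:
  fixes u :: "'a \<Rightarrow> 'b \<Rightarrow> complex"
  assumes "finite F" "finite X" "0 < l" "l \<le> 1"
    and u: "\<And>a x. a \<in> F \<Longrightarrow> x \<in> X \<Longrightarrow> cmod (u a x) \<le> 1"
  shows "\<exists>e. (\<forall>a. e a = 1 \<or> e a = -1) \<and>
           (\<forall>x\<in>X. cmod (\<Sum>a\<in>F. of_real (e a) * u a x)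
              \<le> 2 * (ln (4 * real (card X)) / l + l * real (card F)))"
proof -
  define v where "v = (\<lambda>a (x, b). if b then Re (u a x) else Im (u a x))"
  have "\<bar>v a y\<bar> \<le> 1" if "a \<in> F" "y \<in> X \<times> (UNIV :: bool set)" for a y
    using u[of a "fst y"] that abs_Re_le_cmod[of "u a (fst y)"] abs_Im_le_cmod[of "u a (fst y)"]
    by (auto simp: v_def)
  from ex_signs_cosh_sum_le[of F "X \<times> UNIV" l v, OF assms(1) _ _ this] assms(2,3)
  obtain e where e: "\<forall>a. e a = 1 \<or> e a = -1"
    "(\<Sum>y\<in>X \<times> (UNIV :: bool set). cosh (l * (\<Sum>a\<in>F. e a * v a y)))
       \<le> real (card (X \<times> (UNIV :: bool set))) * cosh l ^ card F"
    by auto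
  let ?b = "ln (4 * real (card X)) / l + l * real (card F)"
  have bound: "\<bar>\<Sum>a\<in>F. e a * v a y\<bar> \<le> ?b" if y: "y \<in> X \<times> UNIV" for y
  proof -
    let ?t = "\<Sum>a\<in>F. e a * v a y"
    have "X \<noteq> {}"
      using y by auto
    then have X: "real (card X) > 0"
      using assms(2) by (simp add: card_gt_0_iff)
    \<comment> \<open>One factor 2 of the constant 4 comes from this halving, the other from the two
      parts of each complex number.\<close>
    have "exp (l * \<bar>?t\<bar>) / 2 \<le> cosh (l * \<bar>?t\<bar>)"
      by (simp add: cosh_field_def)
    also have "cosh (l * \<bar>?t\<bar>) = cosh (l * ?t)"
      using assms(3) by (metis abs_mult abs_of_pos cosh_real_abs)
    also have "\<dots> \<le> (\<Sum>y\<in>X \<times> (UNIV :: bool set). cosh (l * (\<Sum>a\<in>F. e a * v a y)))"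
      by (rule member_le_sum[OF y]) (use assms(2) in auto)
    also have "\<dots> \<le> 2 * real (card X) * cosh l ^ card F"
      using e(2) by (simp add: card_cartesian_product mult_ac)
    also have "\<dots> \<le> 2 * real (card X) * exp (l\<^sup>2) ^ card F"
      using assms(3,4) by (intro mult_left_mono power_mono cosh_le_exp_square) auto
    finally have "exp (l * \<bar>?t\<bar>) \<le> 4 * real (card X) * exp (real (card F) * l\<^sup>2)"
      by (simp add: exp_of_nat_mult)
    also have "\<dots> = exp (ln (4 * real (card X)) + real (card F) * l\<^sup>2)"
      using X by (simp add: exp_add)
    finally have "l * \<bar>?t\<bar> \<le> ln (4 * real (card X)) + real (card F) * l\<^sup>2"
      by simp
    then show ?thesis
      using assms(3) by (simp add: field_simps power2_eq_square)
  qed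
  have "cmod (\<Sum>a\<in>F. of_real (e a) * u a x) \<le> 2 * ?b" if "x \<in> X" for x
  proof -
    have "cmod (\<Sum>a\<in>F. of_real (e a) * u a x)
        \<le> \<bar>\<Sum>a\<in>F. e a * Re (u a x)\<bar> + \<bar>\<Sum>a\<in>F. e a * Im (u a x)\<bar>"
      using cmod_le[of "\<Sum>a\<in>F. of_real (e a) * u a x"] by simp
    also have "\<dots> \<le> 2 * ?b"
      using bound[of "(x, True)"] bound[of "(x, False)"] that by (simp add: v_def)
    finally show ?thesis .
  qed
  with e(1) show ?thesis
    by blast
qed

text \<open>The last hypothesis makes the logarithmic term, for \<open>p ^ n\<close> points, at most
  \<open>l * real (card A)\<close>, which is the size of the other term. The same signs serve every
  \<open>j\<close>, since \<open>j\<close> only selects which coordinates are read.\<close>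

lemma ex_small_block_polynomial:
  assumes "prime p" "n \<ge> 1" "A \<subseteq> PiE {..<n} (\<lambda>_. {0..<int p})" "finite A" "card A = m * n"
    and "0 < l" "l \<le> 1" "3 * real p \<le> l\<^sup>2 * real m"
  obtains e :: "(nat \<Rightarrow> int) \<Rightarrow> real" where "\<And>v. \<bar>e v\<bar> = 1"
    and "\<And>g j. g \<in> carrier (ZpN p) \<Longrightarrow>
      cmod (\<Sum>v\<in>A. of_real (e v) * block_char p n j v g) \<le> 4 * l * real (card A)"
proof -
  have p1: "p > 1"
    using assms(1) by (rule prime_gt_1_nat)
  let ?X = "PiE {..<n} (\<lambda>_. {0..<int p})"
  have finX: "finite ?X"
    by (auto intro: finite_PiE)
  have cardX: "card ?X = p ^ n"
    by (simp add: card_PiE)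
  obtain e :: "(nat \<Rightarrow> int) \<Rightarrow> real" where e: "\<And>v. e v = 1 \<or> e v = -1"
    and bound: "\<And>x. x \<in> ?X \<Longrightarrow> cmod (\<Sum>v\<in>A. of_real (e v) * zexp p (\<Sum>i<n. v i * x i))
            \<le> 2 * (ln (4 * real (card ?X)) / l + l * real (card A))"
    using ex_signs_cmod_le[OF assms(4) finX assms(6,7), of "\<lambda>v x. zexp p (\<Sum>i<n. v i * x i)"]
    by auto
  \<comment> \<open>Crude estimates of both logarithms give a bound linear in \<open>n\<close>,
    comparable with \<open>card A = m * n\<close>.\<close>
  have "ln (4 * real (card ?X)) = ln 4 + real n * ln (real p)"
    using p1 by (simp add: cardX ln_mult ln_realpow)
  also have "\<dots> \<le> 3 + real n * (real p - 1)"
    using ln_le_minus_one[of 4] ln_le_minus_one[of "real p"] p1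
    by (intro add_mono mult_left_mono) auto
  also have "\<dots> \<le> 3 * real p * real n"
  proof -
    have "real n * real p \<ge> 1 * 2"
      using assms(2) p1 by (intro mult_mono) auto
    then show ?thesis
      using assms(2) by (simp add: algebra_simps)
  qed
  also have "\<dots> \<le> l\<^sup>2 * real m * real n"
    using assms(8) by (intro mult_right_mono) auto
  also have "\<dots> = l * (l * real (card A))"
    by (simp add: assms(5) power2_eq_square)
  finally have small: "ln (4 * real (card ?X)) / l \<le> l * real (card A)"
    using assms(6) by (simp add: divide_le_eq mult.commute)
  show thesis
  proof (rule that)
    show "\<bar>e v\<bar> = 1" for v
      using e[of v] by auto
    fix g j assume g: "g \<in> carrier (ZpN p)"
    define x where "x = (\<lambda>i\<in>{..<n}. g (prod_encode (j, i)))"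
    have "x \<in> ?X"
      using g p1 by (auto simp: x_def carrier_ZpN)
    moreover have "block_char p n j v g = zexp p (\<Sum>i<n. v i * x i)" for v
      using g by (simp add: block_char_def x_def)
    ultimately show "cmod (\<Sum>v\<in>A. of_real (e v) * block_char p n j v g) \<le> 4 * l * real (card A)"
      using bound[of x] small by simp
  qed
qed

text \<open>For any candidate constant \<open>S\<close>, a block of large index carries a polynomial
  whose coefficients have total modulus \<open>card (A m)\<close> while its supremum is at most
  \<open>card (A m) / (2 * S)\<close>.\<close>

lemma not_Sidon_blocks:
  assumes "prime p"
    and A: "\<And>m. A m \<subseteq> PiE {..<n m} (\<lambda>_. {0..<int p})" "\<And>m. finite (A m)"
      "\<And>m. card (A m) = Suc m * n m" "\<And>m. n m \<ge> 1"
    and \<Lambda>: "\<And>m. block_char p (n m) m ` A m \<subseteq> \<Lambda>"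
  shows "\<not> Sidon (ZpN p) \<Lambda>"
proof
  assume "Sidon (ZpN p) \<Lambda>"
  then obtain S where S: "S \<ge> 1" "S_Sidon (ZpN p) S \<Lambda>"
    by (auto simp: Sidon_def)
  \<comment> \<open>Chosen so that \<open>S * (4 * l) = 1 / 2\<close>.\<close>
  define l where "l = 1 / (8 * S)"
  have l: "0 < l" "l \<le> 1"
    using S(1) by (simp_all add: l_def)
  obtain m :: nat where "3 * real p / l\<^sup>2 \<le> real m"
    using real_arch_simple by blast
  then have "3 * real p \<le> l\<^sup>2 * real m"
    using l by (simp add: divide_le_eq mult.commute)
  also have "\<dots> \<le> l\<^sup>2 * real (Suc m)"
    by (intro mult_left_mono) auto
  finally have m: "3 * real p \<le> l\<^sup>2 * real (Suc m)" .
  obtain e where e: "\<And>v. \<bar>e v\<bar> = 1"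
    and bound: "\<And>g j. g \<in> carrier (ZpN p) \<Longrightarrow>
      cmod (\<Sum>v\<in>A m. of_real (e v) * block_char p (n m) j v g) \<le> 4 * l * real (card (A m))"
    using ex_small_block_polynomial[OF assms(1) A(4) A(1) A(2) A(3) l m] by metis
  let ?f = "block_char p (n m) m"
  have inj: "inj_on ?f (A m)"
    using inj_on_subset[OF inj_on_block_char[OF prime_gt_1_nat[OF assms(1)]] A(1)] .
  \<comment> \<open>The signs are indexed by vectors but coefficients by characters; injectivity on
    \<open>A m\<close> transports them.\<close>
  define a :: "((nat \<Rightarrow> int) \<Rightarrow> complex) \<Rightarrow> complex"
    where "a = (\<lambda>\<gamma>. of_real (e (the_inv_into (A m) ?f \<gamma>)))"
  have a: "a (?f v) = of_real (e v)" if "v \<in> A m" for v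
    using that inj by (simp add: a_def the_inv_into_f_f)
  have "real (card (A m)) = (\<Sum>\<gamma>\<in>?f ` A m. cmod (a \<gamma>))"
    using inj by (simp add: sum.reindex card_image a_def e)
  also have "\<dots> \<le> S * (SUP g\<in>carrier (ZpN p). cmod (\<Sum>\<gamma>\<in>?f ` A m. a \<gamma> * \<gamma> g))"
    using S(2) A(2) \<Lambda> unfolding S_Sidon_def by blast
  also have "\<dots> \<le> S * (4 * l * real (card (A m)))"
  proof (intro mult_left_mono cSUP_least)
    show "carrier (ZpN p) \<noteq> {}"
      using group.is_monoid[OF group_ZpN] monoid.one_closed by blast
    fix g assume g: "g \<in> carrier (ZpN p)"
    have "(\<Sum>\<gamma>\<in>?f ` A m. a \<gamma> * \<gamma> g) = (\<Sum>v\<in>A m. of_real (e v) * ?f v g)"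
      using inj by (simp add: sum.reindex a)
    then show "cmod (\<Sum>\<gamma>\<in>?f ` A m. a \<gamma> * \<gamma> g) \<le> 4 * l * real (card (A m))"
      using bound[OF g, of m] by simp
  qed (use S(1) in auto)
  also have "\<dots> = real (card (A m)) / 2"
    using S(1) by (simp add: l_def)
  finally have "real (card (A m)) \<le> real (card (A m)) / 2" .
  moreover have "card (A m) > 0"
    using A(4)[of m] by (simp add: A(3))
  ultimately show False
    by simp
qed

section \<open>Assembly of the set from its blocks\<close>

theorem mainTheorem2:
  fixes p :: nat and w :: "real \<Rightarrow> real" and \<Gamma> :: "((nat \<Rightarrow> int) \<Rightarrow> complex) monoid"
  assumes "prime p"
    and "\<Gamma> = dual_group (ZpN p) (ZpN_topology p)"
    and "mono_on {1..} w"
    and "\<And>x. x \<ge> 1 \<Longrightarrow> w x \<ge> 1"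
    and "filterlim w at_top at_top"
  shows "\<exists>\<Lambda>. \<Lambda> \<subseteq> carrier \<Gamma> \<and> \<not> Sidon (ZpN p) \<Lambda> \<and>
           (\<forall>k\<ge>1. \<forall>M. is_mesh \<Gamma> k M \<longrightarrow>
              finite (\<Lambda> \<inter> M) \<and> real (card (\<Lambda> \<inter> M)) \<le> real k * w (real k))"
proof -
  \<comment> \<open>\<open>Suc m\<close> provides the positive ratio that \<open>ex_block\<close>
    asks for.\<close>
  have "\<exists>K n A. K \<ge> 1 \<and> n \<ge> 1 \<and> A \<subseteq> PiE {..<n} (\<lambda>_. {0..<int p}) \<and> finite A \<and>
      card A = Suc m * n \<and> sparse_indep p n K A \<and> real (card A) \<le> w (real K) * real K" for m
    using ex_block[OF assms(1) _ assms(5), of "Suc m"] by simp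
  then obtain K n A where A: "\<And>m. K m \<ge> 1" "\<And>m. n m \<ge> 1"
    "\<And>m. A m \<subseteq> PiE {..<n m} (\<lambda>_. {0..<int p})" "\<And>m. finite (A m)"
    "\<And>m. card (A m) = Suc m * n m" "\<And>m. sparse_indep p (n m) (K m) (A m)"
    "\<And>m. real (card (A m)) \<le> w (real (K m)) * real (K m)"
    by metis
  define f where "f = (\<lambda>(m, v). block_char p (n m) m v)"
  define \<Lambda> where "\<Lambda> = f ` Sigma UNIV A"
  have "\<Lambda> \<subseteq> carrier \<Gamma>"
    using assms(1,2) by (auto simp: \<Lambda>_def f_def block_char_in_dual prime_gt_0_nat)
  moreover have "\<not> Sidon (ZpN p) \<Lambda>"
  proof (rule not_Sidon_blocks[OF assms(1) A(3,4,5,2)])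
    show "block_char p (n m) m ` A m \<subseteq> \<Lambda>" for m
      by (force simp: \<Lambda>_def f_def)
  qed
  moreover have "finite (\<Lambda> \<inter> M) \<and> real (card (\<Lambda> \<inter> M)) \<le> real k * w (real k)"
    if k: "k \<ge> 1" "is_mesh \<Gamma> k M" for k M
  proof -
    let ?C = "nat \<lfloor>real k * w (real k)\<rfloor>"
    have nonneg: "real k * w (real k) \<ge> 0"
      using assms(4)[of "real k"] k by simp
    \<comment> \<open>As \<open>card\<close> of an infinite set is 0, the inequality alone would be
      void there. A uniform bound on finite subsets gives finiteness and the inequality together;
      the floor provides it as a natural number.\<close>
    have "finite (\<Lambda> \<inter> M) \<and> card (\<Lambda> \<inter> M) \<le> ?C"
    proof (rule finite_if_finite_subsets_card_bdd)
      fix G assume G: "G \<subseteq> \<Lambda> \<inter> M" "finite G"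
      then have "G \<subseteq> f ` Sigma UNIV A"
        by (simp add: \<Lambda>_def)
      then obtain T where T: "T \<subseteq> Sigma UNIV A" "finite T" "G = f ` T"
        using finite_subset_image[OF G(2)] by metis
      have "real (card T) \<le> real k * w (real k)"
      proof (rule card_chars_in_mesh_le[OF assms(1,3,4) A(4,6,1,7) k(1) _ T(2,1)])
        show "is_mesh (dual_ZpN p) k M"
          using k(2) assms(2) by simp
        show "block_char p (n m) m v \<in> M" if "(m, v) \<in> T" for m v
          using that G(1) T(3) by (auto simp: f_def)
      qed
      then have "card T \<le> ?C"
        by (simp add: le_nat_floor)
      then show "card G \<le> ?C"
        using card_image_le[OF T(2), of f] T(3) by simp
    qed
    then show ?thesis
      using of_nat_floor[OF nonneg] by (meson of_nat_mono order_trans)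
  qed
  ultimately show ?thesis
    by blast
qed

end
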